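(* Let $\alpha\in\,]0,1]$ and set $y=x^{\alpha}$. There exists a constant $C(\alpha)>0$ such that $$\big|\{n\leqslant x:\ P^+_y(n)<P^+_y(n+1)\}\big|\geqslant C(\alpha)\,x$$ for all sufficiently large $x$.
   Context: $n$ ranges over positive integers. For $2\leqslant y\leqslant x$ and an integer $n\geqslant 1$, $P^+_y(n)=\max\{p \text{ prime}: p\mid n,\ p\leqslant y\}$, with the convention $P^+_y(n)=1$ if $n$ has no prime factor $\leqslant y$. *)

theory Defs
  imports Complex_Main "HOL-Computational_Algebra.Primes"
begin

(* For n = 0 every prime divides n; the definition is only meant for n >= 1. *)
definition largest_prime_factor_upto :: "real \<Rightarrow> nat \<Rightarrow> nat" where
  "largest_prime_factor_upto y n =
     (if \<exists>p. prime p \<and> p dvd n \<and> real p \<le> y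
      then Max {p. prime p \<and> p dvd n \<and> real p \<le> y}
      else 1)"

end

theory Submission
  imports Defs "HOL-Analysis.Analysis" "HOL-Real_Asymp.Real_Asymp"
begin

text \<open>
  Put \<open>X = x powr \<alpha> = y\<close>, \<open>t = X powr 0.48\<close> and \<open>z = X powr 0.49\<close>.
  By Mertens' first theorem, the sum of \<open>1 / p\<close> over the primes in \<open>]t, y]\<close> is below \<open>0.89\<close>,
  so a positive proportion of the \<open>n \<le> x\<close> has no prime factor in \<open>]t, y]\<close>, whence \<open>P\<^sup>+\<^sub>y(n) \<le> t\<close>.
  The primes in \<open>]t, z]\<close> have reciprocal sum at least \<open>0.02\<close>. As products of two of them are
  at most \<open>x powr 0.98\<close>, a second moment computation shows that for all but a small proportion of
  \<open>n\<close> some \<open>n + j\<close> with \<open>1 \<le> j \<le> K = 1000\<close> is divisible by such a prime, so that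
  \<open>P\<^sup>+\<^sub>y(n + j) > t\<close>. Hence a positive proportion of windows of length \<open>K\<close> contains
  an increase, and an increase lies in at most \<open>K\<close> windows.
\<close>

subsection \<open>Chebyshev's bound\<close>

lemma prod_distinct_primes_dvd:
  fixes m :: nat
  assumes "finite P" and "\<And>p. p \<in> P \<Longrightarrow> prime p \<and> p dvd m"
  shows "\<Prod>P dvd m"
  using assms
proof (induction P rule: finite_induct)
  case (insert p P)
  have "coprime p (\<Prod>P)"
    using insert.prems insert.hyps
    by (intro prod_coprime_right) (metis insertCI primes_coprime)
  then show ?case
    using insert by (simp add: divides_mult)
qed simp

text \<open>The two central entries of row \<open>2 * m + 1\<close> are equal, and together they are
  at most the whole row sum \<open>2 * 4 ^ m\<close>.\<close>

lemma middle_binomial_le: "(2 * m + 1) choose m \<le> (4::nat) ^ m"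
proof -
  have "((2 * m + 1) choose m) + ((2 * m + 1) choose (m + 1)) = (\<Sum>k\<in>{m, m + 1}. (2 * m + 1) choose k)"
    by simp
  also have "\<dots> \<le> (\<Sum>k\<le>2 * m + 1. (2 * m + 1) choose k)"
    by (intro sum_mono2) auto
  also have "\<dots> = 2 * 4 ^ m"
    unfolding choose_row_sum by (simp add: power_mult power_add)
  finally show ?thesis
    using binomial_symmetric[of m "2 * m + 1"] by simp
qed

text \<open>Erdos' argument by strong induction. An even \<open>n > 2\<close> is not prime, so
  \<open>n - 1\<close> gives the same product. For \<open>n = 2 * m + 1\<close> the primes in
  \<open>]m + 1, n]\<close> all divide a central binomial coefficient, which is at most
  \<open>4 ^ m\<close>, and the induction hypothesis for \<open>m + 1\<close> handles the
  rest.\<close>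

lemma primorial_le: "\<Prod>{p. prime p \<and> p \<le> n} \<le> (4::nat) ^ n"
proof (induction n rule: less_induct)
  case (less n)
  have fin: "finite {p::nat. prime p \<and> p \<le> k}" for k
    by (rule finite_subset[of _ "{..k}"]) auto
  consider "n \<le> 1" | "n = 2" | "n > 2" "even n" | m where "n = 2 * m + 1" "m \<ge> 1"
    by atomize_elim presburger
  then show ?case
  proof cases
    case 1
    then have empty: "{p::nat. prime p \<and> p \<le> n} = {}"
      by (auto dest: prime_gt_1_nat)
    show ?thesis unfolding empty by simp
  next
    case 2
    then have two: "{p::nat. prime p \<and> p \<le> n} = {2}"
      by (auto dest: prime_gt_1_nat)
    show ?thesis unfolding two using 2 by simp
  next
    case 3
    have "{p::nat. prime p \<and> p \<le> n} = {p. prime p \<and> p \<le> n - 1}"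
      using 3 prime_odd_nat[of n] by (auto simp: le_less)
    with less.IH[of "n - 1"] 3 have "\<Prod>{p. prime p \<and> p \<le> n} \<le> (4::nat) ^ (n - 1)"
      by auto
    also have "\<dots> \<le> 4 ^ n" by (intro power_increasing) auto
    finally show ?thesis .
  next
    case (4 m)
    define B where "B = {p::nat. prime p \<and> m + 1 < p \<and> p \<le> 2 * m + 1}"
    have "finite B" unfolding B_def by (rule finite_subset[OF _ fin[of "2 * m + 1"]]) auto
    have "\<Prod>B dvd (2 * m + 1) choose m"
    proof (rule prod_distinct_primes_dvd[OF \<open>finite B\<close>])
      fix p assume "p \<in> B"
      then have p: "prime p" "m + 1 < p" "p \<le> 2 * m + 1" by (auto simp: B_def)
      \<comment> \<open>As \<open>p\<close> exceeds \<open>m + 1\<close>, it divides neither of the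
        two smaller factorials, so it must divide the binomial coefficient.\<close>
      have "p dvd fact (2 * m + 1)" using p by (subst prime_dvd_fact_iff)
      also have "fact (2 * m + 1) = fact m * fact (m + 1) * ((2 * m + 1) choose m)"
        using binomial_fact_lemma[of m "2 * m + 1"] by simp
      finally show "prime p \<and> p dvd (2 * m + 1) choose m"
        using p by (auto simp: prime_dvd_mult_iff prime_dvd_fact_iff simp del: fact_Suc)
    qed
    then have "\<Prod>B \<le> (2 * m + 1) choose m" by (rule dvd_imp_le) simp
    also have "\<dots> \<le> 4 ^ m" by (rule middle_binomial_le)
    finally have B: "\<Prod>B \<le> 4 ^ m" .
    have "{p. prime p \<and> p \<le> n} = {p. prime p \<and> p \<le> m + 1} \<union> B"
      using 4 by (auto simp: B_def)
    then have "\<Prod>{p. prime p \<and> p \<le> n} = \<Prod>{p. prime p \<and> p \<le> m + 1} * \<Prod>B"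
      using fin[of "m + 1"] \<open>finite B\<close> by (simp add: prod.union_disjoint B_def disjoint_iff)
    also have "\<dots> \<le> 4 ^ (m + 1) * 4 ^ m"
      using less.IH[of "m + 1"] B 4 by (intro mult_mono) auto
    also have "\<dots> = 4 ^ n" using 4 by (simp add: power_add mult_2)
    finally show ?thesis .
  qed
qed

lemma finite_primes_le: "finite {p::nat. prime p \<and> real p \<le> u}"
  by (rule finite_subset[of _ "{..nat \<lfloor>u\<rfloor>}"]) (auto simp: le_nat_floor)

lemma sum_ln_primes_le:
  fixes n :: nat
  shows "(\<Sum>p | prime p \<and> p \<le> n. ln (real p)) \<le> n * ln 4"
proof -
  have "(\<Sum>p | prime p \<and> p \<le> n. ln (real p)) = ln (\<Prod>p | prime p \<and> p \<le> n. real p)"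
    using finite_primes_le[of n] by (subst ln_prod) (auto simp: prime_gt_0_nat)
  also have "(\<Prod>p | prime p \<and> p \<le> n. real p) = real (\<Prod>{p. prime p \<and> p \<le> n})"
    by simp
  also have "ln \<dots> \<le> ln (real (4 ^ n))"
    using primorial_le[of n] by (intro ln_mono) (auto simp: prod_pos prime_gt_0_nat simp del: of_nat_prod of_nat_power)
  also have "\<dots> = n * ln 4" by (simp add: ln_realpow)
  finally show ?thesis .
qed

subsection \<open>Counting in residue classes\<close>

text \<open>This counts the multiples of \<open>d\<close> in \<open>]j, N + j]\<close>; the additive
  form avoids subtraction on naturals and suits the induction on \<open>N\<close>.\<close>

lemma card_dvd_shift:
  assumes "d > 0"
  shows "card {n\<in>{1..N}. d dvd n + j} + j div d = (N + j) div d"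
proof (induction N)
  case (Suc N)
  have "{n\<in>{1..Suc N}. d dvd n + j}
    = {n\<in>{1..N}. d dvd n + j} \<union> (if d dvd Suc N + j then {Suc N} else {})"
    by (auto simp: le_Suc_eq)
  then show ?case
    using Suc by (auto simp: div_Suc mod_eq_0_iff_dvd card_insert_if)
qed simp

lemma card_multiples: "d > 0 \<Longrightarrow> card {n\<in>{1..N}. d dvd n} = N div d"
  using card_dvd_shift[of d N 0] by simp

lemma card_dvd_shift_ge:
  fixes d :: nat
  assumes "d > 0"
  shows "real N / d - 1 \<le> card {n\<in>{1..N}. d dvd n + j}"
proof -
  have "real (N + j) / d < real ((N + j) div d) + 1"
    using floor_divide_of_nat_eq[of "N + j" d, where ?'a = real] by linarith
  moreover have "real (j div d) \<le> real j / d"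
    by (rule of_nat_div_le_of_nat)
  moreover have "real (card {n\<in>{1..N}. d dvd n + j}) + real (j div d) = real ((N + j) div d)"
    using card_dvd_shift[OF assms] by (metis of_nat_add)
  ultimately show ?thesis by (simp add: add_divide_distrib)
qed

text \<open>Elements of a single residue class modulo \<open>m\<close> are determined by their
  quotients \<open>n div m\<close>, which take at most \<open>N div m + 1\<close> values. Which
  class it is does not matter, so no Chinese remainder theorem is involved.\<close>

lemma card_congruent_le:
  fixes X :: "nat set"
  assumes "m > 0" "X \<subseteq> {1..N}" "\<And>a b. a \<in> X \<Longrightarrow> b \<in> X \<Longrightarrow> a \<le> b \<Longrightarrow> m dvd b - a"
  shows "real (card X) \<le> real N / m + 1"
proof -
  have "inj_on (\<lambda>n. n div m) X"
  proof (rule inj_onI)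
    fix a b assume *: "a \<in> X" "b \<in> X" "a div m = b div m"
    then have "a mod m = b mod m"
      by (metis assms(3) mod_eq_dvd_iff_nat nle_le)
    then show "a = b" using * by (metis div_mod_decomp)
  qed
  moreover have "(\<lambda>n. n div m) ` X \<subseteq> {..N div m}"
    using assms(2) by (force intro: div_le_mono)
  ultimately have "card X \<le> N div m + 1"
    by (metis card_atMost card_inj_on_le finite_atMost Suc_eq_plus1)
  then have "real (card X) \<le> real (N div m) + 1" by linarith
  also have "\<dots> \<le> real N / m + 1"
    using of_nat_div_le_of_nat by (intro add_right_mono)
  finally show ?thesis .
qed

subsection \<open>Mertens' first theorem\<close>

text \<open>The common range \<open>{1..n}\<close> for the exponents, independent of
  \<open>m\<close>, lets the two summations be swapped in Legendre's formula.\<close>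

lemma multiplicity_eq_card:
  fixes p m n :: nat
  assumes "prime p" "0 < m" "m \<le> n"
  shows "multiplicity p m = card {k\<in>{1..n}. p ^ k dvd m}"
proof -
  have "p ^ multiplicity p m \<le> m"
    using assms by (intro dvd_imp_le multiplicity_dvd) auto
  then have le: "multiplicity p m \<le> n"
    using assms prime_gt_1_nat[of p] power_gt_expt[of p "multiplicity p m"] by simp
  have "{k\<in>{1..n}. p ^ k dvd m} = {k\<in>{1..n}. k \<le> multiplicity p m}"
    using assms by (subst power_dvd_iff_le_multiplicity) auto
  also have "\<dots> = {1..multiplicity p m}"
    using le by auto
  finally show ?thesis by simp
qed

lemma legendre_formula:
  fixes p n :: nat
  assumes "prime p"
  shows "multiplicity p (fact n :: nat) = (\<Sum>k=1..n. n div p ^ k)"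
proof -
  have "multiplicity p (fact n :: nat) = (\<Sum>m=1..n. multiplicity p m)"
    unfolding fact_prod of_nat_id using assms
    by (subst prime_elem_multiplicity_prod_distrib) auto
  also have "\<dots> = (\<Sum>m=1..n. card {k\<in>{1..n}. p ^ k dvd m})"
    using assms by (intro sum.cong multiplicity_eq_card) auto
  also have "\<dots> = (\<Sum>m=1..n. \<Sum>k=1..n. if p ^ k dvd m then 1 else 0)"
    by (simp add: sum.If_cases Int_def)
  also have "\<dots> = (\<Sum>k=1..n. \<Sum>m=1..n. if p ^ k dvd m then 1 else 0)"
    by (rule sum.swap)
  also have "\<dots> = (\<Sum>k=1..n. card {m\<in>{1..n}. p ^ k dvd m})"
    by (simp add: sum.If_cases Int_def)
  also have "\<dots> = (\<Sum>k=1..n. n div p ^ k)"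
    using assms by (intro sum.cong refl card_multiples) (auto simp: prime_gt_0_nat)
  finally show ?thesis .
qed

text \<open>Dropping the roundings in Legendre's formula leaves a geometric series.\<close>

lemma multiplicity_fact_le:
  fixes p n :: nat
  assumes "prime p"
  shows "real (multiplicity p (fact n :: nat)) \<le> n / (real p - 1)"
proof -
  have p: "real p > 1" using prime_gt_1_nat[OF assms] by simp
  have "real (multiplicity p (fact n :: nat)) \<le> (\<Sum>k=1..n. n / p ^ k)"
    unfolding legendre_formula[OF assms] of_nat_sum
    by (intro sum_mono) (metis of_nat_div_le_of_nat of_nat_power)
  also have "\<dots> = n * (\<Sum>k=1..n. (1 / p) ^ k)"
    by (simp add: sum_distrib_left power_one_over)
  also have "(\<Sum>k=1..n. (1 / real p) ^ k) = (1 - (1 / p) ^ n) / (real p - 1)"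
    using p by (subst sum_gp) (auto simp: field_simps)
  also have "real n * \<dots> \<le> n * (1 / (real p - 1))"
    using p by (intro mult_left_mono divide_right_mono) auto
  finally show ?thesis using p by simp
qed

text \<open>Only the term \<open>k = 1\<close> of Legendre's formula is kept.\<close>

lemma multiplicity_fact_ge:
  fixes p n :: nat
  assumes "prime p"
  shows "real n / p - 1 \<le> multiplicity p (fact n :: nat)"
proof (cases "n = 0")
  case False
  have "n div p ^ 1 \<le> (\<Sum>k=1..n. n div p ^ k)"
    using False by (intro member_le_sum) auto
  then have "n div p \<le> multiplicity p (fact n :: nat)"
    using legendre_formula[OF assms] by simp
  moreover have "real n / p < real (n div p) + 1"
    using floor_divide_of_nat_eq[of n p, where ?'a = real] by linarith
  ultimately show ?thesis by linarith
qed simp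

lemma ln_fact_eq_sum_primes:
  "ln (fact n) = (\<Sum>p | prime p \<and> p \<le> n. multiplicity p (fact n :: nat) * ln (real p))"
proof -
  have "(fact n :: nat) = (\<Prod>p\<in>prime_factors (fact n). p ^ multiplicity p (fact n :: nat))"
    by (rule prime_factorization_nat) simp
  also have "prime_factors (fact n :: nat) = {p. prime p \<and> p \<le> n}"
    by (auto simp: prime_factors_dvd prime_dvd_fact_iff)
  finally have "ln (real (fact n))
      = ln (real (\<Prod>p | prime p \<and> p \<le> n. p ^ multiplicity p (fact n :: nat)))"
    by simp
  also have "\<dots> = (\<Sum>p | prime p \<and> p \<le> n. ln (real p ^ multiplicity p (fact n :: nat)))"
    unfolding of_nat_prod of_nat_power using finite_primes_le[of n]
    by (subst ln_prod) (auto simp: prime_gt_0_nat)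
  also have "\<dots> = (\<Sum>p | prime p \<and> p \<le> n. multiplicity p (fact n :: nat) * ln (real p))"
    by (intro sum.cong) (auto simp: ln_realpow prime_gt_0_nat)
  finally show ?thesis by simp
qed

lemma ln_fact_le: "ln (fact n) \<le> n * ln (real n)"
proof (cases "n = 0")
  case False
  have "ln (fact n) \<le> ln (real n ^ n)"
    using False fact_le_power[of n, where ?'a = real] by (intro ln_mono) auto
  then show ?thesis using False by (simp add: ln_realpow)
qed simp

text \<open>A weak Stirling bound: from \<open>n\<close> to \<open>n + 1\<close> the left side grows
  by \<open>ln (n + 1) + n * ln (1 + 1 / n) - 1\<close>, which is at most
  \<open>ln (n + 1)\<close>.\<close>

lemma ln_fact_ge: "n * ln (real n) - n \<le> ln (fact n)"
proof (induction n)
  case (Suc n)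
  show ?case
  proof (cases "n = 0")
    case False
    then have n: "real n > 0" by simp
    have "1 + 1 / real n = real (Suc n) / n"
      using n by (simp add: field_simps)
    then have "ln (real (Suc n)) - ln n = ln (1 + 1 / n)"
      using n by (simp add: ln_div)
    also have "\<dots> \<le> 1 / n"
      using n by (intro ln_add_one_self_le_self) simp
    finally have "n * (ln (real (Suc n)) - ln n) \<le> 1"
      using n by (simp add: field_simps)
    moreover have "ln (fact (Suc n)) = ln (real (Suc n)) + ln (fact n)"
      by (simp add: ln_mult)
    ultimately show ?thesis using Suc by (simp add: algebra_simps)
  qed simp
qed simp

text \<open>This is the cost of replacing \<open>1 / (p - 1)\<close> by \<open>1 / p\<close> in the
  lower half of Mertens' theorem. The bounds \<open>ln p \<le> 2 * sqrt p\<close> and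
  \<open>p * (p - 1) \<ge> p^2 / 2\<close> dominate the terms by a convergent series.\<close>

lemma sum_ln_over_prime_times_pred_bounded: 
  "\<exists>C. \<forall>n. (\<Sum>p | prime p \<and> p \<le> n. ln (real p) / (real p * (real p - 1))) \<le> C"
proof -
  define g where "g m = 4 * real m powr (-3/2)" for m
  have g: "summable g"
    unfolding g_def by (intro summable_mult) (simp add: summable_real_powr_iff)
  have "(\<Sum>p | prime p \<and> p \<le> n. ln (real p) / (real p * (real p - 1))) \<le> suminf g" for n
  proof -
    have le: "ln (real p) / (real p * (real p - 1)) \<le> g p" if "prime p" for p
    proof -
      have p: "p \<ge> 2" "real p \<ge> 2" using prime_ge_2_nat[OF that] by auto
      have "ln (real p) \<le> p powr (1/2) / (1/2)"
        using p by (intro ln_powr_bound) auto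
      moreover have "real p * (real p - 1) \<ge> p powr 2 / 2"
        using p by (auto simp: field_simps power2_eq_square)
      ultimately have "ln (real p) / (real p * (real p - 1)) \<le> (p powr (1/2) / (1/2)) / (p powr 2 / 2)"
        using p by (intro frac_le) auto
      also have "\<dots> = 4 * (p powr (1/2) / p powr 2)" by simp
      also have "\<dots> = g p" unfolding g_def powr_diff[symmetric] by simp
      finally show ?thesis .
    qed
    have "(\<Sum>p | prime p \<and> p \<le> n. ln (real p) / (real p * (real p - 1))) \<le> (\<Sum>p | prime p \<and> p \<le> n. g p)"
      using le by (intro sum_mono) auto
    also have "\<dots> \<le> suminf g"
      using finite_primes_le[of n] by (intro sum_le_suminf g) (auto simp: g_def)
    finally show ?thesis .
  qed
  then show ?thesis by blast
qed

definition mertens_sum :: "real \<Rightarrow> real" where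
  "mertens_sum u = (\<Sum>p | prime p \<and> real p \<le> u. ln (real p) / p)"

text \<open>Compare \<open>ln (fact n) \<le> n * ln n\<close> with the prime factorization of
  \<open>fact n\<close>, each multiplicity being at least \<open>n / p - 1\<close>. Chebyshev's
  bound pays for the terms \<open>-1\<close>, at a cost of \<open>ln 4\<close>.\<close>

lemma mertens_sum_nat_le:
  assumes "n \<ge> 1"
  shows "mertens_sum (real n) \<le> ln n + ln 4"
proof -
  have "n * mertens_sum (real n) - (\<Sum>p | prime p \<and> p \<le> n. ln (real p))
      = (\<Sum>p | prime p \<and> p \<le> n. (n / p - 1) * ln (real p))"
    by (simp add: mertens_sum_def sum_distrib_left sum_subtractf left_diff_distrib)
  also have "\<dots> \<le> ln (fact n)"
    unfolding ln_fact_eq_sum_primes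
    by (intro sum_mono mult_right_mono multiplicity_fact_ge) (auto simp: prime_gt_0_nat Suc_leI)
  also have "\<dots> \<le> n * ln (real n)" by (rule ln_fact_le)
  finally have "n * mertens_sum (real n) \<le> n * (ln n + ln 4)"
    using sum_ln_primes_le[of n] by (simp add: algebra_simps)
  then show ?thesis using assms by simp
qed

text \<open>The same comparison in the other direction, with multiplicities at most
  \<open>n / (p - 1)\<close> and the weak Stirling bound.\<close>

lemma mertens_sum_nat_ge: "\<exists>C. \<forall>n\<ge>1. mertens_sum (real n) \<ge> ln n - C"
proof -
  obtain C where C: "\<And>n::nat. (\<Sum>p | prime p \<and> p \<le> n. ln (real p) / (real p * (real p - 1))) \<le> C"
    using sum_ln_over_prime_times_pred_bounded by blast
  have "mertens_sum (real n) \<ge> ln n - (C + 1)" if "n \<ge> 1" for n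
  proof -
    have "n * ln (real n) - n \<le> ln (fact n)" by (rule ln_fact_ge)
    also have "\<dots> \<le> (\<Sum>p | prime p \<and> p \<le> n. n / (real p - 1) * ln (real p))"
      unfolding ln_fact_eq_sum_primes
      by (intro sum_mono mult_right_mono multiplicity_fact_le) (auto simp: prime_gt_0_nat Suc_leI)
    \<comment> \<open>Here \<open>1 / (p - 1) = 1 / p + 1 / (p * (p - 1))\<close>; the second part
      contributes a bounded sum.\<close>
    also have "\<dots> = (\<Sum>p | prime p \<and> p \<le> n. n * (ln p / p + ln (real p) / (real p * (real p - 1))))"
    proof (intro sum.cong refl)
      fix p assume "p \<in> {p. prime p \<and> p \<le> n}"
      then have "real p > 1" using prime_gt_1_nat[of p] by auto
      then show "n / (real p - 1) * ln (real p) = n * (ln p / p + ln (real p) / (real p * (real p - 1)))"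
        by (simp add: field_simps)
    qed
    also have "\<dots> = n * (mertens_sum n + (\<Sum>p | prime p \<and> p \<le> n. ln (real p) / (real p * (real p - 1))))"
      by (simp add: mertens_sum_def flip: sum_distrib_left sum.distrib)
    also have "\<dots> \<le> n * (mertens_sum n + C)"
      using C[of n] by (intro mult_left_mono) auto
    finally have "n * (ln n - 1) \<le> n * (mertens_sum n + C)"
      by (simp add: algebra_simps)
    then show ?thesis using that by simp
  qed
  then show ?thesis by blast
qed

lemma mertens_first: "\<exists>C. \<forall>u\<ge>1. \<bar>mertens_sum u - ln u\<bar> \<le> C"
proof -
  obtain C where C: "\<And>n::nat. n \<ge> 1 \<Longrightarrow> mertens_sum (real n) \<ge> ln n - C"
    using mertens_sum_nat_ge by blast
  have "\<bar>mertens_sum u - ln u\<bar> \<le> \<bar>C\<bar> + ln 4" if "u \<ge> 1" for u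
  proof -
    define n where "n = nat \<lfloor>u\<rfloor>"
    have n: "n \<ge> 1" "real n \<le> u" "u < real n + 1"
      using that by (auto simp: n_def le_nat_iff of_nat_nat)
    have "mertens_sum u = mertens_sum n"
      unfolding mertens_sum_def using n by (intro sum.cong) auto
    moreover have "ln (real n) \<le> ln u" using n by simp
    \<comment> \<open>Since \<open>u < n + 1 \<le> 2 * n\<close>, the factor 4 is generous; it makes
      the rounding cost the same \<open>ln 4\<close> as in the upper bound.\<close>
    moreover have "ln u \<le> ln (4 * real n)" using n by (intro ln_mono) auto
    moreover have "ln (4 * real n) = ln 4 + ln (real n)" using n by (simp add: ln_mult)
    ultimately show ?thesis
      using C[OF n(1)] mertens_sum_nat_le[OF n(1)] by linarith
  qed
  then show ?thesis by blast
qed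

lemma mertens_sum_diff:
  assumes "u \<le> v"
  shows "mertens_sum v - mertens_sum u = (\<Sum>p | prime p \<and> u < real p \<and> real p \<le> v. ln (real p) / p)"
proof -
  have "{p. prime p \<and> real p \<le> v}
      = {p. prime p \<and> real p \<le> u} \<union> {p. prime p \<and> u < real p \<and> real p \<le> v}"
    using assms by auto
  moreover have "finite {p. prime p \<and> u < real p \<and> real p \<le> v}"
    by (rule finite_subset[OF _ finite_primes_le[of v]]) auto
  ultimately show ?thesis
    unfolding mertens_sum_def using finite_primes_le[of u]
    by (simp add: sum.union_disjoint disjoint_iff)
qed

section \<open>Reciprocal sums of primes over an interval\<close>

definition recip_primes :: "real \<Rightarrow> real \<Rightarrow> real" where
  "recip_primes u v = (\<Sum>p | prime p \<and> u < real p \<and> real p \<le> v. 1 / real p)"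

text \<open>On \<open>]u, v]\<close> the weight \<open>ln p\<close> lies between \<open>ln u\<close>
  and \<open>ln v\<close>, so it can be divided out at either end.\<close>

lemma recip_primes_bounds:
  assumes "1 < u" "u \<le> v"
  shows "recip_primes u v \<le> (mertens_sum v - mertens_sum u) / ln u"
    and "(mertens_sum v - mertens_sum u) / ln v \<le> recip_primes u v"
proof -
  show "recip_primes u v \<le> (mertens_sum v - mertens_sum u) / ln u"
    unfolding recip_primes_def mertens_sum_diff[OF assms(2)] sum_divide_distrib
    using assms by (intro sum_mono) (auto simp: field_simps prime_gt_0_nat)
  show "(mertens_sum v - mertens_sum u) / ln v \<le> recip_primes u v"
    unfolding recip_primes_def mertens_sum_diff[OF assms(2)] sum_divide_distrib
    using assms by (intro sum_mono) (auto simp: field_simps prime_gt_0_nat)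
qed

lemma recip_primes_add:
  assumes "u \<le> v" "v \<le> w"
  shows "recip_primes u w = recip_primes u v + recip_primes v w"
proof -
  have "{p. prime p \<and> u < real p \<and> real p \<le> w}
      = {p. prime p \<and> u < real p \<and> real p \<le> v} \<union> {p. prime p \<and> v < real p \<and> real p \<le> w}"
    using assms by auto
  moreover have "finite {p. prime p \<and> a < real p \<and> real p \<le> b}" for a b
    by (rule finite_subset[OF _ finite_primes_le[of b]]) auto
  ultimately show ?thesis
    unfolding recip_primes_def by (simp add: sum.union_disjoint disjoint_iff)
qed

text \<open>The true limit is \<open>ln (b / a)\<close>; the cruder bounds \<open>b / a - 1\<close> and \<open>1 - a / b\<close>
  only need Mertens' first theorem, not partial summation.\<close>
lemma recip_primes_powr:
  fixes a b c :: real
  assumes "0 < a" "a < b"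
  shows "b / a - 1 < c \<Longrightarrow> \<forall>\<^sub>F X in at_top. recip_primes (X powr a) (X powr b) < c"
    and "c < 1 - a / b \<Longrightarrow> \<forall>\<^sub>F X in at_top. c < recip_primes (X powr a) (X powr b)"
proof -
  obtain C where C: "\<And>u. u \<ge> 1 \<Longrightarrow> \<bar>mertens_sum u - ln u\<bar> \<le> C"
    using mertens_first by blast
  have *: "1 < X powr a" "X powr a \<le> X powr b"
      "\<bar>mertens_sum (X powr b) - mertens_sum (X powr a) - (b - a) * ln X\<bar> \<le> 2 * C"
      if "X > 1" for X
  proof -
    show a: "1 < X powr a" "X powr a \<le> X powr b" using that assms by (auto intro: gr_one_powr powr_mono)
    then have b: "1 < X powr b" by linarith
    show "\<bar>mertens_sum (X powr b) - mertens_sum (X powr a) - (b - a) * ln X\<bar> \<le> 2 * C"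
      using C[of "X powr a"] C[of "X powr b"] a b that unfolding left_diff_distrib
      by (simp only: ln_powr) linarith
  qed
  show "\<forall>\<^sub>F X in at_top. recip_primes (X powr a) (X powr b) < c" if "b / a - 1 < c"
  proof -
    \<comment> \<open>The Mertens errors at both ends add up to at most \<open>2 * C\<close>,
      negligible against \<open>a * ln X = ln (X powr a)\<close>, so the bound tends to
      \<open>b / a - 1\<close>.\<close>
    have "((\<lambda>X. ((b - a) * ln X + 2 * C) / (a * ln X)) \<longlongrightarrow> (b - a) * inverse a) at_top"
      using assms by real_asymp
    moreover have "(b - a) * inverse a < c"
      using that assms by (simp add: left_diff_distrib divide_inverse)
    ultimately have "\<forall>\<^sub>F X in at_top. ((b - a) * ln X + 2 * C) / (a * ln X) < c"
      by (rule order_tendstoD)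
    then show ?thesis
      using eventually_gt_at_top[of 1]
    proof eventually_elim
      case (elim X)
      have "recip_primes (X powr a) (X powr b)
          \<le> (mertens_sum (X powr b) - mertens_sum (X powr a)) / ln (X powr a)"
        using elim * by (intro recip_primes_bounds) auto
      also have "\<dots> = (mertens_sum (X powr b) - mertens_sum (X powr a)) / (a * ln X)"
        using elim by (simp add: ln_powr)
      also have "\<dots> \<le> ((b - a) * ln X + 2 * C) / (a * ln X)"
        using *(3)[of X] elim assms by (intro divide_right_mono) auto
      finally show ?case using elim by linarith
    qed
  qed
  show "\<forall>\<^sub>F X in at_top. c < recip_primes (X powr a) (X powr b)" if "c < 1 - a / b"
  proof -
    have "((\<lambda>X. ((b - a) * ln X - 2 * C) / (b * ln X)) \<longlongrightarrow> (b - a) * inverse b) at_top"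
      using assms by real_asymp
    moreover have "c < (b - a) * inverse b"
      using that assms by (simp add: left_diff_distrib divide_inverse)
    ultimately have "\<forall>\<^sub>F X in at_top. c < ((b - a) * ln X - 2 * C) / (b * ln X)"
      by (rule order_tendstoD)
    then show ?thesis
      using eventually_gt_at_top[of 1]
    proof eventually_elim
      case (elim X)
      have "((b - a) * ln X - 2 * C) / (b * ln X)
          \<le> (mertens_sum (X powr b) - mertens_sum (X powr a)) / (b * ln X)"
        using *(3)[of X] elim assms by (intro divide_right_mono) auto
      also have "\<dots> = (mertens_sum (X powr b) - mertens_sum (X powr a)) / ln (X powr b)"
        using elim by (simp add: ln_powr)
      also have "\<dots> \<le> recip_primes (X powr a) (X powr b)"
        using elim * by (intro recip_primes_bounds) auto
      finally show ?case using elim by linarith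
    qed
  qed
qed

subsection \<open>Second moment over short windows\<close>

lemma dvd_diff_shift:
  fixes p :: nat
  shows "p dvd a + i \<Longrightarrow> p dvd b + i \<Longrightarrow> p dvd b - a"
  using dvd_diff_nat[of p "b + i" "a + i"] by simp

lemma card_two_prime_divisors_le:
  fixes p q :: nat
  assumes "prime p" "prime q" "p \<noteq> q"
  shows "real (card {n\<in>{1..N}. p dvd n + i \<and> q dvd n + j}) \<le> real N / (p * q) + 1"
proof -
  have "real (card {n\<in>{1..N}. p dvd n + i \<and> q dvd n + j}) \<le> real N / real (p * q) + 1"
  proof (rule card_congruent_le)
    show "p * q > 0" using assms by (simp add: prime_gt_0_nat)
    fix a b
    assume "a \<in> {n\<in>{1..N}. p dvd n + i \<and> q dvd n + j}"
      and "b \<in> {n\<in>{1..N}. p dvd n + i \<and> q dvd n + j}"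
    then have "p dvd b - a" "q dvd b - a"
      using dvd_diff_shift by blast+
    then show "p * q dvd b - a"
      using assms by (simp add: divides_mult primes_coprime)
  qed blast
  then show ?thesis by simp
qed

lemma card_prime_divisor_le:
  fixes p :: nat
  assumes "prime p"
  shows "real (card {n\<in>{1..N}. p dvd n + i}) \<le> real N / p + 1"
proof (rule card_congruent_le)
  show "p > 0" using assms by (simp add: prime_gt_0_nat)
  show "p dvd b - a" if "a \<in> {n\<in>{1..N}. p dvd n + i}" "b \<in> {n\<in>{1..N}. p dvd n + i}" for a b
    using that dvd_diff_shift by blast
qed blast

text \<open>\<open>S n\<close> counts the pairs \<open>(j, p)\<close> with
  \<open>p dvd n + j\<close>, on average about \<open>K * L\<close>. Distinct primes behave
  independently up to a rounding error of 1, so the terms \<open>N * (K * L)^2\<close> cancel when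
  the square is expanded. What remains is the diagonal, of size about \<open>K * N * L\<close>, and
  rounding errors involving only \<open>card P\<close>.\<close>

lemma window_second_moment:
  fixes P :: "nat set" and N K :: nat and L :: real
  assumes "finite P" and P: "\<And>p. p \<in> P \<Longrightarrow> prime p \<and> K \<le> p"
  defines "L \<equiv> (\<Sum>p\<in>P. 1 / real p)"
  defines "S \<equiv> (\<lambda>n. \<Sum>(j, p)\<in>{1..K} \<times> P. of_bool (p dvd n + j) :: real)"
  shows "(\<Sum>n=1..N. (S n - K * L)\<^sup>2)
    \<le> K\<^sup>2 * (card P)\<^sup>2 + K * (N * L + card P) + 2 * K\<^sup>2 * L * card P"
proof -
  define I where "I = {1..K} \<times> P"
  define e where "e n i = (of_bool (snd i dvd n + fst i) :: real)" for n and i :: "nat \<times> nat"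
  have fin: "finite I" using assms by (simp add: I_def)
  have S: "S n = (\<Sum>i\<in>I. e n i)" for n
    by (simp add: S_def I_def e_def split_def)
  \<comment> \<open>The first bracket is the count expected from independence plus rounding; the
    second is charged only on the diagonal.\<close>
  have pair: "(\<Sum>n=1..N. e n i * e n i')
      \<le> (N * (1 / real (snd i) * (1 / real (snd i'))) + 1) + (if i = i' then N / real (snd i) + 1 else 0)"
    if iI: "i \<in> I" and iI': "i' \<in> I" for i i'
  proof -
    obtain j p where i: "i = (j, p)" "j \<in> {1..K}" "p \<in> P"
      using iI by (cases i) (auto simp: I_def)
    obtain j' q where i': "i' = (j', q)" "j' \<in> {1..K}" "q \<in> P"
      using iI' by (cases i') (auto simp: I_def)
    have "(\<Sum>n=1..N. e n i * e n i') = card {n\<in>{1..N}. p dvd n + j \<and> q dvd n + j'}"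
      by (simp add: e_def i i' of_bool_conj[symmetric] Int_def del: of_bool_conj)
    also have "\<dots> \<le> (N * (1 / p * (1 / q)) + 1) + (if i = i' then N / p + 1 else 0)"
    proof (cases "p = q")
      case False
      then show ?thesis
        using card_two_prime_divisors_le[of p q N j j'] P i i' by simp
    next
      case True
      show ?thesis
      proof (cases "j = j'")
        case True
        then have "real (card {n\<in>{1..N}. p dvd n + j \<and> q dvd n + j'}) \<le> N / p + 1"
          using card_prime_divisor_le[of p N j] P i \<open>p = q\<close> by simp
        also have "\<dots> \<le> (N * (1 / p * (1 / q)) + 1) + (N / p + 1)"
          by simp
        finally show ?thesis using \<open>p = q\<close> \<open>j = j'\<close> i i' by simp
      next
        case False
        \<comment> \<open>A window has at most \<open>K \<le> p\<close> elements, so \<open>p\<close> divides at most one of them.\<close>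
        have "\<not> (p dvd n + j \<and> p dvd n + j')" for n
        proof
          assume *: "p dvd n + j \<and> p dvd n + j'"
          then have "p dvd j - j'" "p dvd j' - j"
            using dvd_diff_nat[of p "n + j" "n + j'"] dvd_diff_nat[of p "n + j'" "n + j"] by auto
          moreover have "j - j' < p" "j' - j < p" using i i' P[OF i(3)] by auto
          ultimately have "j - j' = 0" "j' - j = 0"
            by (meson gr0I nat_dvd_not_less)+
          then show False using False by simp
        qed
        then have empty: "{n\<in>{1..N}. p dvd n + j \<and> q dvd n + j'} = {}"
          using \<open>p = q\<close> by blast
        show ?thesis unfolding empty by simp
      qed
    qed
    finally show ?thesis by (simp only: i(1) i'(1) snd_conv)
  qed
  have SL: "(\<Sum>i\<in>I. 1 / real (snd i)) = K * L"
    unfolding I_def L_def using sum.cartesian_product[of "\<lambda>j p. 1 / real p" P "{1..K}"]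
    by (simp add: split_def)
  have cI: "card I = K * card P" unfolding I_def card_cartesian_product by simp
  have "(\<Sum>n=1..N. (S n)\<^sup>2) = (\<Sum>n=1..N. \<Sum>i\<in>I. \<Sum>i'\<in>I. e n i * e n i')"
    by (simp add: S power2_eq_square sum_product)
  also have "\<dots> = (\<Sum>i\<in>I. \<Sum>i'\<in>I. \<Sum>n=1..N. e n i * e n i')"
    by (subst sum.swap, intro sum.cong refl, rule sum.swap)
  also have "\<dots> \<le> (\<Sum>i\<in>I. \<Sum>i'\<in>I. (N * (1 / real (snd i) * (1 / real (snd i'))) + 1)
      + (if i = i' then N / real (snd i) + 1 else 0))"
    using pair by (intro sum_mono)
  also have "\<dots> = N * (\<Sum>i\<in>I. \<Sum>i'\<in>I. 1 / real (snd i) * (1 / real (snd i'))) + (card I)\<^sup>2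
      + (N * (\<Sum>i\<in>I. 1 / real (snd i)) + card I)"
    using fin by (simp add: sum.distrib sum_distrib_left power2_eq_square)
  also have "\<dots> = N * (K * L)\<^sup>2 + (K * card P)\<^sup>2 + (N * (K * L) + K * card P)"
    unfolding sum_product[symmetric] SL cI by (simp add: power2_eq_square)
  finally have second: "(\<Sum>n=1..N. (S n)\<^sup>2)
    \<le> N * (K * L)\<^sup>2 + (K * card P)\<^sup>2 + (N * (K * L) + K * card P)" .
  \<comment> \<open>The first moment enters the variance with the factor
    \<open>- 2 * (K * L)\<close>, so it is bounded from below.\<close>
  have "N * (K * L) - K * card P = (\<Sum>i\<in>I. N * (1 / real (snd i)) - 1)"
    unfolding sum_subtractf sum_distrib_left[symmetric] SL using cI by simp
  also have "\<dots> \<le> (\<Sum>i\<in>I. \<Sum>n=1..N. e n i)"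
  proof (intro sum_mono)
    fix i assume "i \<in> I"
    then have "snd i > 0" using P by (auto simp: I_def prime_gt_0_nat)
    then show "N * (1 / real (snd i)) - 1 \<le> (\<Sum>n=1..N. e n i)"
      using card_dvd_shift_ge[of "snd i" N "fst i"] by (simp add: e_def Int_def)
  qed
  also have "\<dots> = (\<Sum>n=1..N. S n)"
    unfolding S by (rule sum.swap)
  finally have first: "N * (K * L) - K * card P \<le> (\<Sum>n=1..N. S n)" .
  have "L \<ge> 0" unfolding L_def by (intro sum_nonneg) simp
  have "(\<Sum>n=1..N. (S n - K * L)\<^sup>2) = (\<Sum>n=1..N. (S n)\<^sup>2) - 2 * (K * L) * (\<Sum>n=1..N. S n) + N * (K * L)\<^sup>2"
    by (simp add: power2_diff sum.distrib sum_subtractf sum_distrib_left algebra_simps)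
  also have "\<dots> \<le> N * (K * L)\<^sup>2 + (K * card P)\<^sup>2 + (N * (K * L) + K * card P)
      - 2 * (K * L) * (N * (K * L) - K * card P) + N * (K * L)\<^sup>2"
    using second first \<open>L \<ge> 0\<close> by (intro add_right_mono diff_mono mult_left_mono) auto
  also have "\<dots> = K\<^sup>2 * (card P)\<^sup>2 + K * (N * L + card P) + 2 * K\<^sup>2 * L * card P"
    by (simp add: power2_eq_square algebra_simps)
  finally show ?thesis .
qed

text \<open>Chebyshev's inequality: in a window without such a divisor \<open>S n = 0\<close>, a
  deviation by the full mean \<open>K * L\<close>.\<close>

lemma card_empty_windows_le:
  fixes P :: "nat set" and N K :: nat and L :: real
  assumes "finite P" and "\<And>p. p \<in> P \<Longrightarrow> prime p \<and> K \<le> p"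
  defines "L \<equiv> (\<Sum>p\<in>P. 1 / real p)"
  shows "card {n\<in>{1..N}. \<forall>j\<in>{1..K}. \<forall>p\<in>P. \<not> p dvd n + j} * (K * L)\<^sup>2
    \<le> K\<^sup>2 * (card P)\<^sup>2 + K * (N * L + card P) + 2 * K\<^sup>2 * L * card P"
proof -
  define S where "S n = (\<Sum>(j, p)\<in>{1..K} \<times> P. of_bool (p dvd n + j) :: real)" for n
  define B where "B = {n\<in>{1..N}. \<forall>j\<in>{1..K}. \<forall>p\<in>P. \<not> p dvd n + j}"
  have "S n = 0" if "n \<in> B" for n
    using that unfolding S_def B_def by (intro sum.neutral) auto
  then have "card B * (K * L)\<^sup>2 = (\<Sum>n\<in>B. (S n - K * L)\<^sup>2)"
    by simp
  also have "\<dots> \<le> (\<Sum>n=1..N. (S n - K * L)\<^sup>2)"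
    by (intro sum_mono2) (auto simp: B_def)
  also have "\<dots> \<le> K\<^sup>2 * (card P)\<^sup>2 + K * (N * L + card P) + 2 * K\<^sup>2 * L * card P"
    unfolding S_def L_def by (intro window_second_moment assms)
  finally show ?thesis unfolding B_def .
qed

text \<open>A union bound: remove from \<open>{1..N}\<close> the multiples of each prime in
  \<open>]t, y]\<close>, at most \<open>N / p\<close> for each.\<close>

lemma card_no_prime_between_ge:
  fixes N :: nat
  shows "N * (1 - recip_primes t y)
    \<le> card {n\<in>{1..N}. \<forall>p. prime p \<and> t < real p \<and> real p \<le> y \<longrightarrow> \<not> p dvd n}"
proof -
  define Q where "Q = {p. prime p \<and> t < real p \<and> real p \<le> y}"
  define A where "A = {n\<in>{1..N}. \<forall>p. prime p \<and> t < real p \<and> real p \<le> y \<longrightarrow> \<not> p dvd n}"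
  have "finite Q"
    unfolding Q_def by (rule finite_subset[OF _ finite_primes_le[of y]]) auto
  have "{1..N} \<subseteq> A \<union> (\<Union>p\<in>Q. {n\<in>{1..N}. p dvd n})"
    by (auto simp: A_def Q_def)
  then have "card {1..N} \<le> card (A \<union> (\<Union>p\<in>Q. {n\<in>{1..N}. p dvd n}))"
    using \<open>finite Q\<close> by (intro card_mono) (auto simp: A_def)
  also have "\<dots> \<le> card A + (\<Sum>p\<in>Q. card {n\<in>{1..N}. p dvd n})"
    using \<open>finite Q\<close> by (intro order_trans[OF card_Un_le] add_left_mono card_UN_le)
  also have "(\<Sum>p\<in>Q. card {n\<in>{1..N}. p dvd n}) = (\<Sum>p\<in>Q. N div p)"
    by (intro sum.cong refl card_multiples) (auto simp: Q_def prime_gt_0_nat)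
  finally have "real N \<le> real (card A + (\<Sum>p\<in>Q. N div p))"
    unfolding of_nat_le_iff by simp
  also have "\<dots> = card A + real (\<Sum>p\<in>Q. N div p)"
    by (rule of_nat_add)
  also have "real (\<Sum>p\<in>Q. N div p) \<le> (\<Sum>p\<in>Q. N * (1 / real p))"
    unfolding of_nat_sum using of_nat_div_le_of_nat[of N] by (intro sum_mono) simp
  also have "\<dots> = N * recip_primes t y"
    by (simp add: recip_primes_def Q_def sum_distrib_left)
  finally show ?thesis unfolding A_def[symmetric] by (simp add: algebra_simps)
qed

subsection \<open>Increases of the truncated largest prime factor\<close>

lemma finite_prime_divisors: "n > 0 \<Longrightarrow> finite {p::nat. prime p \<and> p dvd n \<and> real p \<le> y}"
  by (rule finite_subset[of _ "{..n}"]) (auto intro: dvd_imp_le)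

text \<open>The hypothesis \<open>1 \<le> t\<close> takes care of the default value 1, and
  \<open>n > 0\<close> makes the set under \<open>Max\<close> finite.\<close>

lemma largest_prime_factor_upto_le:
  assumes "n > 0" "1 \<le> t" "\<And>p. prime p \<Longrightarrow> t < real p \<Longrightarrow> real p \<le> y \<Longrightarrow> \<not> p dvd n"
  shows "real (largest_prime_factor_upto y n) \<le> t"
proof (cases "\<exists>p. prime p \<and> p dvd n \<and> real p \<le> y")
  case True
  define m where "m = Max {p. prime p \<and> p dvd n \<and> real p \<le> y}"
  have "m \<in> {p. prime p \<and> p dvd n \<and> real p \<le> y}"
    unfolding m_def using True assms(1) by (intro Max_in finite_prime_divisors) auto
  then have "real m \<le> t"
    using assms(3)[of m] by (auto simp: not_less[symmetric])
  then show ?thesis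
    using True by (simp add: largest_prime_factor_upto_def m_def)
next
  case False
  then show ?thesis
    using assms(2) unfolding largest_prime_factor_upto_def by (simp only: if_False of_nat_1)
qed

lemma largest_prime_factor_upto_ge:
  assumes "n > 0" "prime p" "p dvd n" "real p \<le> y"
  shows "p \<le> largest_prime_factor_upto y n"
  using assms by (auto simp: largest_prime_factor_upto_def intro!: Max_ge finite_prime_divisors)

text \<open>Induction on \<open>j\<close>: either \<open>f n < f (n + j)\<close> already holds, or
  \<open>f (n + j) \<le> f n < f (n + j + 1)\<close> and the last step is an increase.\<close>

lemma increase_step:
  fixes f :: "nat \<Rightarrow> nat"
  assumes "f n < f (n + j)"
  shows "\<exists>i<j. f (n + i) < f (n + i + 1)"
  using assms
proof (induction j)
  case (Suc j)
  then show ?case by (cases "f n < f (n + j)") (auto intro: less_SucI)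
qed simp

text \<open>For \<open>n\<close> in \<open>A - B\<close>, \<open>f n \<le> t\<close> while
  \<open>f (n + j) > t\<close> for some \<open>j \<le> K\<close>, so an increase occurs at some
  \<open>n + i\<close> with \<open>i < K\<close>. Each increase serves at most \<open>K\<close>
  values of \<open>n\<close>. The bracket is the bound on the empty windows \<open>B\<close>,
  divided by \<open>(K * L)^2\<close>; \<open>K \<le> t\<close> ensures that every \<open>p\<close>
  in \<open>P\<close> is at least \<open>K\<close>.\<close>

lemma count_increases:
  fixes N K :: nat and t z y L :: real
  assumes "1 \<le> t" "z \<le> y" "K \<le> t" "0 < K"
  defines "f \<equiv> largest_prime_factor_upto y"
    and "P \<equiv> {p. prime p \<and> t < real p \<and> real p \<le> z}" and "L \<equiv> recip_primes t z"
  assumes "0 < L"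
  shows "N * (1 - recip_primes t y)
      - ((card P)\<^sup>2 / L\<^sup>2 + N / (K * L) + card P / (K * L\<^sup>2) + 2 * card P / L)
    \<le> K * (real (card {n\<in>{1..N}. f n < f (n + 1)}) + K)"
proof -
  define A where "A = {n\<in>{1..N}. \<forall>p. prime p \<and> t < real p \<and> real p \<le> y \<longrightarrow> \<not> p dvd n}"
  define B where "B = {n\<in>{1..N}. \<forall>j\<in>{1..K}. \<forall>p\<in>P. \<not> p dvd n + j}"
  define D where "D = {n\<in>{1..N}. f n < f (n + 1)}"
  have "finite P" unfolding P_def by (rule finite_subset[OF _ finite_primes_le[of z]]) auto
  \<comment> \<open>Increases found beyond \<open>N\<close> are not counted in \<open>D\<close>; the
    at most \<open>K\<close> possible positions are added in full.\<close>
  have "A - B \<subseteq> (\<Union>i<K. (\<lambda>m. m - i) ` (D \<union> {N<..N + K}))"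
  proof
    fix n assume n: "n \<in> A - B"
    then obtain j p where jp: "j \<in> {1..K}" "p \<in> P" "p dvd n + j"
      by (auto simp: A_def B_def)
    have "real (f n) \<le> t"
      unfolding f_def using n assms(1) by (intro largest_prime_factor_upto_le) (auto simp: A_def)
    also have "t < p" using jp by (simp add: P_def)
    also have "p \<le> f (n + j)"
      unfolding f_def using jp n assms(2)
      by (intro largest_prime_factor_upto_ge) (auto simp: P_def A_def)
    finally have "f n < f (n + j)" by simp
    then obtain i where i: "i < j" "f (n + i) < f (n + i + 1)"
      using increase_step by blast
    have "n + i \<in> D \<union> {N<..N + K}"
      using n i jp by (auto simp: D_def A_def)
    then show "n \<in> (\<Union>i<K. (\<lambda>m. m - i) ` (D \<union> {N<..N + K}))"
      using i jp by (intro UN_I[of i] image_eqI[of _ _ "n + i"]) auto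
  qed
  then have "card (A - B) \<le> card (\<Union>i<K. (\<lambda>m. m - i) ` (D \<union> {N<..N + K}))"
    by (intro card_mono) (auto simp: D_def)
  also have "\<dots> \<le> (\<Sum>i<K. card ((\<lambda>m. m - i) ` (D \<union> {N<..N + K})))"
    by (intro card_UN_le) simp
  also have "\<dots> \<le> (\<Sum>i<K. card D + K)"
  proof (intro sum_mono)
    fix i
    have "card ((\<lambda>m. m - i) ` (D \<union> {N<..N + K})) \<le> card (D \<union> {N<..N + K})"
      by (intro card_image_le) (auto simp: D_def)
    also have "\<dots> \<le> card D + card {N<..N + K}" by (rule card_Un_le)
    finally show "card ((\<lambda>m. m - i) ` (D \<union> {N<..N + K})) \<le> card D + K" by simp
  qed
  finally have "card (A - B) \<le> K * (card D + K)" by simp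
  then have upper: "real (card (A - B)) \<le> K * (real (card D) + K)"
    by (metis of_nat_add of_nat_le_iff of_nat_mult)
  have "card A \<le> card ((A - B) \<union> B)"
    by (intro card_mono) (auto simp: A_def B_def)
  then have "card A \<le> card (A - B) + card B"
    using card_Un_le[of "A - B" B] by linarith
  moreover have "N * (1 - recip_primes t y) \<le> card A"
    unfolding A_def by (rule card_no_prime_between_ge)
  moreover have "card B \<le> (card P)\<^sup>2 / L\<^sup>2 + N / (K * L) + card P / (K * L\<^sup>2) + 2 * card P / L"
  proof -
    have L: "L = (\<Sum>p\<in>P. 1 / real p)" by (simp add: L_def P_def recip_primes_def)
    have P: "prime p \<and> K \<le> p" if "p \<in> P" for p
      using that assms(3) by (auto simp: P_def)
    have "card B * (K * L)\<^sup>2 \<le> K\<^sup>2 * (card P)\<^sup>2 + K * (N * L + card P) + 2 * K\<^sup>2 * L * card P"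
      unfolding B_def L by (rule card_empty_windows_le[OF \<open>finite P\<close> P])
    also have "\<dots> = ((card P)\<^sup>2 / L\<^sup>2 + N / (K * L) + card P / (K * L\<^sup>2) + 2 * card P / L) * (K * L)\<^sup>2"
      using assms by (simp add: field_simps power2_eq_square)
    finally show ?thesis using assms by (simp add: mult_le_cancel_right)
  qed
  ultimately show ?thesis using upper unfolding D_def by linarith
qed

section \<open>Choice of exponents and conclusion\<close>

lemma card_primes_between_le:
  assumes "0 \<le> z"
  shows "real (card {p. prime p \<and> t < real p \<and> real p \<le> z}) \<le> z"
proof -
  have "{p. prime p \<and> t < real p \<and> real p \<le> z} \<subseteq> {1..nat \<lfloor>z\<rfloor>}"
    by (auto simp: le_nat_floor prime_gt_0_nat Suc_leI)
  then have "card {p. prime p \<and> t < real p \<and> real p \<le> z} \<le> nat \<lfloor>z\<rfloor>"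
    by (metis card_atLeastAtMost card_mono diff_Suc_1 finite_atLeastAtMost One_nat_def)
  then show ?thesis using assms by linarith
qed

theorem theorem2:
  fixes \<alpha> :: real
  assumes "0 < \<alpha>" and "\<alpha> \<le> 1"
  shows "\<exists>C::real. C > 0 \<and>
    (\<forall>\<^sub>F x::real in at_top.
      real (card {n::nat. 1 \<le> n \<and> real n \<le> x \<and>
        largest_prime_factor_upto (x powr \<alpha>) n
          < largest_prime_factor_upto (x powr \<alpha>) (n + 1)}) \<ge> C * x)"
proof -
  \<comment> \<open>The exponent of \<open>t\<close> must stay below \<open>1/2\<close> for the second moment, and then the bound
    \<open>b / a - 1\<close> over the whole range up to \<open>X powr 1\<close> exceeds \<open>1\<close>; splitting at
    \<open>69/100\<close> brings it down to \<open>11/25 + 9/20 < 1\<close>.\<close>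
  define t z :: "real \<Rightarrow> real" where "t X = X powr (12/25)" and "z X = X powr (49/100)" for X
  have "\<forall>\<^sub>F X in at_top. recip_primes (t X) (X powr (69/100)) < (11/25)"
    unfolding t_def by (rule recip_primes_powr) auto
  moreover have "\<forall>\<^sub>F X in at_top. recip_primes (X powr (69/100)) (X powr 1) < (9/20)"
    by (rule recip_primes_powr) auto
  \<comment> \<open>Here \<open>1 - a / b = 1 - 48/49 = 1/49\<close>, just above
    \<open>1/50\<close>.\<close>
  moreover have "\<forall>\<^sub>F X in at_top. (1/50) < recip_primes (t X) (z X)"
    unfolding t_def z_def by (rule recip_primes_powr) auto
  moreover have "\<forall>\<^sub>F X::real in at_top. 1000 \<le> t X"
    unfolding t_def by real_asymp
  \<comment> \<open>The constant 7503 generously exceeds the sum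
    \<open>2500 + 2500/1000 + 100\<close> of error coefficients found below, and 1001001 covers
    \<open>K * K = 1000000\<close> and the rounding of \<open>x\<close> to \<open>N\<close>.\<close>
  moreover have "\<forall>\<^sub>F X::real in at_top. 7503 * X powr (49/50) + 1001001 \<le> (1/25) * X"
    by real_asymp
  ultimately have ev: "\<forall>\<^sub>F X in at_top. recip_primes (t X) (X powr (69/100)) < (11/25) \<and>
      recip_primes (X powr (69/100)) (X powr 1) < (9/20) \<and> (1/50) < recip_primes (t X) (z X) \<and>
      1000 \<le> t X \<and> 7503 * X powr (49/50) + 1001001 \<le> (1/25) * X"
    by eventually_elim simp
  have "filterlim (\<lambda>x::real. x powr \<alpha>) at_top at_top"
    using assms by real_asymp
  from filterlim_iff[THEN iffD1, OF this, rule_format, OF ev]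
  \<comment> \<open>The density left is \<open>11/100 - 1/20 - 1/25 = 1/50\<close>; division by
    \<open>K = 1000\<close> gives \<open>1/50000\<close>, twice the constant claimed.\<close>
  have "\<forall>\<^sub>F x::real in at_top.
      real (card {n::nat. 1 \<le> n \<and> real n \<le> x \<and>
        largest_prime_factor_upto (x powr \<alpha>) n
          < largest_prime_factor_upto (x powr \<alpha>) (n + 1)}) \<ge> (1/100000) * x"
    using eventually_gt_at_top[of 1]
  proof eventually_elim
    case (elim x)
    define X where "X = x powr \<alpha>"
    define N where "N = nat \<lfloor>x\<rfloor>"
    define L where "L = recip_primes (t X) (z X)"
    define Z where "Z = real (card {p. prime p \<and> t X < real p \<and> real p \<le> z X})"
    define D where "D = {n\<in>{1..N}. largest_prime_factor_upto X n < largest_prime_factor_upto X (n + 1)}"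
    \<comment> \<open>The assumption \<open>\<alpha> \<le> 1\<close> gives \<open>X \<le> x\<close>,
      so errors bounded by \<open>X / 25\<close> are also small against \<open>x\<close>.\<close>
    have X: "1 < X" "X \<le> x" "X powr 1 = X"
      using elim assms powr_mono[of \<alpha> 1 x] by (auto simp: X_def gr_one_powr)
    have powr_le: "X powr a \<le> X" if "a \<le> 1" for a
      using powr_mono[of a 1 X] that X by simp
    note large = elim(1)[folded X_def, folded L_def]
    have N: "real N \<le> x" "x < real N + 1"
      using elim by (auto simp: N_def)
    have Dx: "{n::nat. 1 \<le> n \<and> real n \<le> x \<and>
        largest_prime_factor_upto (x powr \<alpha>) n
          < largest_prime_factor_upto (x powr \<alpha>) (n + 1)} = D"
      using N by (auto simp: D_def X_def)
    have "recip_primes (t X) X = recip_primes (t X) (X powr (69/100)) + recip_primes (X powr (69/100)) (X powr 1)"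
      using recip_primes_add[of "t X" "X powr (69/100)" "X powr 1"] powr_mono[of "12/25" "69/100" X] powr_le[of "69/100"] X
      by (simp add: t_def)
    moreover have "recip_primes (t X) (X powr (69/100)) < (11/25)" "recip_primes (X powr (69/100)) (X powr 1) < (9/20)"
      using large by blast+
    ultimately have "(11/100) \<le> 1 - recip_primes (t X) X"
      by linarith
    then have "N * (11/100) \<le> N * (1 - recip_primes (t X) X)"
      by (intro mult_left_mono) auto
    moreover have "N * (1 - recip_primes (t X) X)
        - (Z\<^sup>2 / L\<^sup>2 + N / (1000 * L) + Z / (1000 * L\<^sup>2) + 2 * Z / L) \<le> 1000 * (real (card D) + 1000)"
    proof -
      have "1 \<le> t X" "z X \<le> X" "real 1000 \<le> t X" "0 < recip_primes (t X) (z X)"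
        using large powr_le by (auto simp: z_def L_def)
      from count_increases[OF this(1-3) _ this(4), of N] show ?thesis
        by (simp only: D_def L_def Z_def of_nat_numeral of_nat_power zero_less_numeral True_implies_equals)
    qed
    moreover have "Z\<^sup>2 / L\<^sup>2 + N / (1000 * L) + Z / (1000 * L\<^sup>2) + 2 * Z / L \<le> (1/20) * N + 7503 * X powr (49/50)"
    proof -
      \<comment> \<open>With \<open>1 / L \<le> 50\<close> and \<open>K = 1000\<close>, the only
        error term proportional to \<open>N\<close> is at most \<open>N / 20\<close>.\<close>
      have L: "1 / L \<le> 50" using large by (simp add: field_simps)
      then have L2: "1 / L\<^sup>2 \<le> 2500"
        using power_mono[OF L, of 2] large by (simp add: power_one_over)
      \<comment> \<open>The trivial count suffices: its square has exponent
        \<open>49/50 < 1\<close>.\<close>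
      have "Z \<le> X powr (49/100)"
        unfolding Z_def z_def by (rule card_primes_between_le) simp
      moreover have "Z \<ge> 0" by (simp add: Z_def)
      ultimately have "Z\<^sup>2 \<le> (X powr (49/100))\<^sup>2" by (intro power_mono)
      also have "\<dots> = X powr (49/50)"
        using X by (simp add: power2_eq_square flip: powr_add)
      finally have Z2: "Z\<^sup>2 \<le> X powr (49/50)" .
      have Z1: "Z \<le> X powr (49/50)"
        using \<open>Z \<le> X powr (49/100)\<close> X
        by (intro order_trans[OF _ powr_mono[of "49/100" "49/50" X]]) auto
      \<comment> \<open>Naming the products as variables turns the estimate into pure linear
        arithmetic.\<close>
      have combine: "e \<le> (1/20) * n + 7503 * w"
        if "e = a + b / 1000 + c / 1000 + 2 * d" "a \<le> w * 2500" "b \<le> n * 50" "c \<le> w * 2500"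
          "d \<le> w * 50" "0 \<le> w" for a b c d e n w :: real
        using that by linarith
      show ?thesis
      proof (rule combine)
        show "Z\<^sup>2 / L\<^sup>2 + N / (1000 * L) + Z / (1000 * L\<^sup>2) + 2 * Z / L
            = Z\<^sup>2 * (1 / L\<^sup>2) + N * (1 / L) / 1000 + Z * (1 / L\<^sup>2) / 1000 + 2 * (Z * (1 / L))"
          by simp
        show "Z\<^sup>2 * (1 / L\<^sup>2) \<le> X powr (49/50) * 2500"
          using Z2 L2 by (intro mult_mono) auto
        show "real N * (1 / L) \<le> real N * 50" using L by (intro mult_left_mono) auto
        show "Z * (1 / L\<^sup>2) \<le> X powr (49/50) * 2500"
          using Z1 L2 by (intro mult_mono) auto
        show "Z * (1 / L) \<le> X powr (49/50) * 50"
          using Z1 L large by (intro mult_mono) auto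
      qed simp
    qed
    ultimately have "(1/100000) * x \<le> card D"
    proof -
      have combine: "(1/100000) * x \<le> d"
        if "n * (11/100) \<le> m" "m - e \<le> 1000 * (d + 1000)" "e \<le> (1/20) * n + 7503 * w"
          "7503 * w + 1001001 \<le> (1/25) * X" "x < n + 1" for d e m n w :: real
      proof -
        have "1000 * (d + 1000) = 1000 * d + 1000000" by simp
        with that show ?thesis using X(1,2) by linarith
      qed
      assume "real N * (11/100) \<le> N * (1 - recip_primes (t X) X)"
        and "N * (1 - recip_primes (t X) X)
            - (Z\<^sup>2 / L\<^sup>2 + N / (1000 * L) + Z / (1000 * L\<^sup>2) + 2 * Z / L) \<le> 1000 * (real (card D) + 1000)"
        and "Z\<^sup>2 / L\<^sup>2 + N / (1000 * L) + Z / (1000 * L\<^sup>2) + 2 * Z / L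
            \<le> (1/20) * N + 7503 * X powr (49/50)"
      then show ?thesis
        by (rule combine) (use large N in auto)
    qed
    then show ?case unfolding Dx .
  qed
  then show ?thesis by (intro exI[of _ "1/100000"]) auto
qed

end
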